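(* Let $q\in\mathbb{C}^\times$ be transcendental, let $r\in\mathbb{N}$ and $a\in\mathbb{C}^\times$, and let $V^{(r)}(a)$ be the spin $r/2$ evaluation representation of the quantum affine algebra $U_q(\tilde{\mathfrak{sl}}_2)$, with basis $v_0,v_1,\dots,v_r$. For $k=0,1,\dots,r$ define polynomials with constant term $1$ by $$Q_{k,a}(u)=\prod_{m=k+1}^{r}\left(1-q^{r-2m+1}au\right),\qquad R_{k,a}(u)=\prod_{m=1}^{k}\left(1-q^{r-2m+3}au\right).$$ Then for every $k=0,1,\dots,r$ the vector $v_k$ spans a loop-weight space of $V^{(r)}(a)$ of loop-weight $Q_{k,a}R_{k,a}^{-1}$. That is, the line $\mathbb{C}v_k$ is the simultaneous generalised eigenspace of the operators $\varPhi^{\pm}_{s}$ ($s\in\mathbb{Z}$) whose eigenvalues $\psi^\pm_{s}$ are given by $$\sum_{s\ge 0}\psi^{\pm}_{\pm s}u^{\pm s}=q^{\deg Q_{k,a}-\deg R_{k,a}}\,\frac{Q_{k,a}(q^{-2}u)\,R_{k,a}(u)}{Q_{k,a}(u)\,R_{k,a}(q^{-2}u)}$$ as elements of $\mathbb{C}[[u^{\pm1}]]$, respectively (i.e. the series with upper sign is the expansion of the right-hand side at $u=0$, and the series with lower sign its expansion at $u=\infty$). In particular, every eigenvalue of $\sum_{s\ge0}\varPhi^\pm_{\pm s}u^{\pm s}$ on $V^{(r)}(a)$ has the form $q^{\deg Q-\deg R}\frac{Q(q^{-2}u)R(u)}{Q(u)R(q^{-2}u)}$ with polynomials $Q,R\in\mathbb{C}[u]$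 of constant term $1$.
   Context: Write $[n]_q=\frac{q^n-q^{-n}}{q-q^{-1}}$. On the representations considered here the central element $\mathcal{C}^{1/2}$ of $U_q(\tilde{\mathfrak{sl}}_2)$ acts as the identity, so they are representations of the quantum loop algebra $U_q(\mathfrak{L}(\mathfrak{sl}_2))=U_q(\tilde{\mathfrak{sl}}_2)/(\mathcal{C}^{1/2}-1)$. This is the associative $\mathbb{C}$-algebra with generators $\mathcal{K}^{\pm1}$, $\mathcal{H}_{s}$ ($s\in\mathbb{Z}\setminus\{0\}$), $\mathcal{X}^\pm_{s}$ ($s\in\mathbb{Z}$) and relations (second Drinfeld realization): $\mathcal{K}\mathcal{K}^{-1}=\mathcal{K}^{-1}\mathcal{K}=1$; the $\mathcal{K}^{\pm1}$ and all $\mathcal{H}_s$ commute with each other; $\mathcal{K}\mathcal{X}^\pm_s\mathcal{K}^{-1}=q^{\pm2}\mathcal{X}^\pm_s$; $[\mathcal{H}_s,\mathcal{X}^\pm_p]=\pm\frac1s[2s]_q\mathcal{X}^\pm_{p+s}$; $\mathcal{X}^\pm_{p+1}\mathcal{X}^\pm_s-q^{\pm2}\mathcal{X}^\pm_s\mathcal{X}^\pm_{p+1}=q^{\pm2}\mathcal{X}^\pm_p\mathcal{X}^\pm_{s+1}-\mathcal{X}^\pm_{s+1}\mathcal{X}^\pm_p$; $[\mathcal{X}^+_p,\mathcal{X}^-_s]=\frac{\varPhi^+_{p+s}-\varPhi^-_{p+s}}{q-q^{-1}}$, where the $\varPhi^\pm_s$ are defined by $$\sum_{s\ge0}\varPhi^\pm_{\pm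 s}u^{\pm s}=\mathcal{K}^{\pm1}\exp\Big(\pm(q-q^{-1})\sum_{s\ge1}\mathcal{H}_{\pm s}u^{\pm s}\Big),$$ with $\varPhi^+_s=0$ for $s<0$ and $\varPhi^-_s=0$ for $s>0$. The spin $r/2$ evaluation representation $V^{(r)}(a)$ is the pull-back, under Jimbo's evaluation homomorphism at $a$, of the $(r+1)$-dimensional irreducible type $\boldsymbol 1$ representation of $U_q(\mathfrak{sl}_2)$. Explicitly, it has basis $v_0,\dots,v_r$ (with $v_{-1}=v_{r+1}=0$) and action, for $p\in\mathbb{Z}$, $$\mathcal{K}v_k=q^{r-2k}v_k,\quad \mathcal{X}^+_{p}v_k=a^pq^{p(r-2k+1)}[r-k+1]_q\,v_{k-1},\quad \mathcal{X}^-_{p}v_k=a^pq^{p(r-2k-1)}[k+1]_q\,v_{k+1}.$$ For a finite-dimensional representation $V$ on which $\mathcal{C}^{1/2}$ acts as $1$, the operators $\varPhi^\pm_s$ commute. For a family $\boldsymbol\psi=(\psi^\pm_s)_{s\in\mathbb{Z}}$ of complex numbers, the loop-weight space $V_{\boldsymbol\psi}$ is the simultaneous generalised eigenspace $\{v\in V:\exists p,\ (\varPhi^\pm_s-\psi^\pm_s)^pv=0\ \text{for all } s\}$ (when non-zero). If $\sum_{s\ge0}\psi^\pm_{\pm s}u^{\pm s}=q^{\deg Q-\deg R}\frac{Q(q^{-2}u)R(u)}{Q(u)R(q^{-2}u)}$ in $\mathbb{C}[[u^{\pm1}]]$ with polynomials $Q,R$ of constant term $1$, then $QR^{-1}$ is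 called the loop-weight of $V_{\boldsymbol\psi}$. *)

theory Defs
  imports Complex_Main "HOL-Computational_Algebra.Computational_Algebra"
begin

definition qint :: "complex \<Rightarrow> int \<Rightarrow> complex" where
  "qint q n = (q powi n - q powi (- n)) / (q - inverse q)"

text \<open>The superscript \<open>\<pm>\<close> of \<open>X\<^sup>\<pm>\<close>, \<open>\<Phi>\<^sup>\<pm>\<close> and \<open>\<psi>\<^sup>\<pm>\<close>.\<close>

datatype pm = Plus | Minus

fun sg :: "pm \<Rightarrow> int" where
  "sg Plus = 1"
| "sg Minus = - 1"

text \<open>A sequence of operators \<open>A\<close> stands for the formal series \<open>\<Sum>n. A n z^n\<close>; the coefficient of
  \<open>z^n\<close> in its \<open>m\<close>-th power is \<open>oser_power A m n\<close>. The exponential \<open>\<Sum>m. A^m / m!\<close> is only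
  used for series without constant term, so that the coefficient of \<open>z^n\<close> in \<open>A^m\<close> vanishes
  for \<open>m > n\<close> and the sum below may stop at \<open>n\<close>.\<close>

primrec oser_power :: "(nat \<Rightarrow> 'v \<Rightarrow> 'v::ab_group_add) \<Rightarrow> nat \<Rightarrow> nat \<Rightarrow> 'v \<Rightarrow> 'v" where
  "oser_power A 0 n x = (if n = 0 then x else 0)"
| "oser_power A (Suc m) n x = (\<Sum>i\<le>n. A i (oser_power A m (n - i) x))"

definition oser_exp ::
  "(complex \<Rightarrow> 'v \<Rightarrow> 'v::ab_group_add) \<Rightarrow> (nat \<Rightarrow> 'v \<Rightarrow> 'v) \<Rightarrow> nat \<Rightarrow> 'v \<Rightarrow> 'v" where
  "oser_exp scale A n x = (\<Sum>m\<le>n. scale (1 / fact m) (oser_power A m n x))"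

text \<open>\<open>loop_Phi scale q K Kinv H \<epsilon> s\<close> is the operator \<open>\<Phi>\<^sup>\<epsilon>\<close> with (signed) index \<open>s\<close>: with
  \<open>z = u\<close> for \<open>\<epsilon> = +\<close> and \<open>z = u^-1\<close> for \<open>\<epsilon> = -\<close>, the series of all \<open>\<Phi>\<^sup>\<epsilon>\<close> with index \<open>\<epsilon>n\<close>,
  \<open>n \<ge> 0\<close>, at \<open>z^n\<close> is \<open>K^\<epsilon> exp (\<epsilon>(q - q^-1) \<Sum>j\<ge>1. H (\<epsilon>j) z^j)\<close>.\<close>

definition loop_Phi ::
  "(complex \<Rightarrow> 'v \<Rightarrow> 'v::ab_group_add) \<Rightarrow> complex \<Rightarrow> ('v \<Rightarrow> 'v) \<Rightarrow> ('v \<Rightarrow> 'v) \<Rightarrow> (int \<Rightarrow> 'v \<Rightarrow> 'v)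
    \<Rightarrow> pm \<Rightarrow> int \<Rightarrow> 'v \<Rightarrow> 'v" where
  "loop_Phi scale q K Kinv H \<epsilon> s x =
     (if sg \<epsilon> * s < 0 then 0
      else (case \<epsilon> of Plus \<Rightarrow> K | Minus \<Rightarrow> Kinv)
        (oser_exp scale
          (\<lambda>j y. if j = 0 then 0
                 else scale (of_int (sg \<epsilon>) * (q - inverse q)) (H (sg \<epsilon> * int j) y))
          (nat (sg \<epsilon> * s)) x))"

text \<open>A representation of the quantum loop algebra of \<open>sl\<^sub>2\<close> on a complex vector space, given by
  the operators by which the generators act. There is no generator \<open>H 0\<close>: nothing is
  assumed about this value, and nothing depends on it.\<close>

locale quantum_loop_rep = vector_space scale
  for scale :: "complex \<Rightarrow> 'v \<Rightarrow> 'v::ab_group_add" +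
  fixes q :: complex
    and K Kinv :: "'v \<Rightarrow> 'v"
    and H :: "int \<Rightarrow> 'v \<Rightarrow> 'v"
    and X :: "pm \<Rightarrow> int \<Rightarrow> 'v \<Rightarrow> 'v"
  assumes linear_K: "Vector_Spaces.linear scale scale K"
    and linear_Kinv: "Vector_Spaces.linear scale scale Kinv"
    and linear_H: "s \<noteq> 0 \<Longrightarrow> Vector_Spaces.linear scale scale (H s)"
    and linear_X: "Vector_Spaces.linear scale scale (X \<epsilon> p)"
    and K_Kinv: "K (Kinv x) = x"
    and Kinv_K: "Kinv (K x) = x"
    and K_H: "s \<noteq> 0 \<Longrightarrow> K (H s x) = H s (K x)"
    and Kinv_H: "s \<noteq> 0 \<Longrightarrow> Kinv (H s x) = H s (Kinv x)"
    and H_H: "s \<noteq> 0 \<Longrightarrow> p \<noteq> 0 \<Longrightarrow> H s (H p x) = H p (H s x)"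
    and K_X: "K (X \<epsilon> s (Kinv x)) = scale (q powi (2 * sg \<epsilon>)) (X \<epsilon> s x)"
    and H_X: "s \<noteq> 0 \<Longrightarrow> H s (X \<epsilon> p x) - X \<epsilon> p (H s x)
               = scale (of_int (sg \<epsilon>) * (1 / of_int s) * qint q (2 * s)) (X \<epsilon> (p + s) x)"
    and X_X: "X \<epsilon> (p + 1) (X \<epsilon> s x) - scale (q powi (2 * sg \<epsilon>)) (X \<epsilon> s (X \<epsilon> (p + 1) x))
               = scale (q powi (2 * sg \<epsilon>)) (X \<epsilon> p (X \<epsilon> (s + 1) x)) - X \<epsilon> (s + 1) (X \<epsilon> p x)"
    and Xp_Xm: "X Plus p (X Minus s x) - X Minus s (X Plus p x)
               = scale (1 / (q - inverse q))
                   (loop_Phi scale q K Kinv H Plus (p + s) x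
                    - loop_Phi scale q K Kinv H Minus (p + s) x)"

text \<open>The spin \<open>r/2\<close> evaluation representation at \<open>a\<close>. The action of the \<open>H s\<close> is not prescribed:
  the relations determine it from the action of the other generators.\<close>

locale evaluation_rep = quantum_loop_rep scale q K Kinv H X
  for scale :: "complex \<Rightarrow> 'v \<Rightarrow> 'v::ab_group_add"
    and q :: complex
    and K Kinv :: "'v \<Rightarrow> 'v"
    and H :: "int \<Rightarrow> 'v \<Rightarrow> 'v"
    and X :: "pm \<Rightarrow> int \<Rightarrow> 'v \<Rightarrow> 'v" +
  fixes r :: nat
    and a :: complex
    and v :: "nat \<Rightarrow> 'v"
  assumes basis_inj: "inj_on v {..r}"
    and basis_independent: "independent (v ` {..r})"
    and basis_span: "span (v ` {..r}) = UNIV"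
    and K_basis: "k \<le> r \<Longrightarrow> K (v k) = scale (q powi (int r - 2 * int k)) (v k)"
    and Xp_basis: "k \<le> r \<Longrightarrow> X Plus p (v k)
          = scale (a powi p * q powi (p * (int r - 2 * int k + 1)) * qint q (int r - int k + 1))
              (if k = 0 then 0 else v (k - 1))"
    and Xm_basis: "k \<le> r \<Longrightarrow> X Minus p (v k)
          = scale (a powi p * q powi (p * (int r - 2 * int k - 1)) * qint q (int k + 1))
              (if k = r then 0 else v (k + 1))"

definition loop_weight_space ::
  "(complex \<Rightarrow> 'v \<Rightarrow> 'v::ab_group_add) \<Rightarrow> (pm \<Rightarrow> int \<Rightarrow> 'v \<Rightarrow> 'v) \<Rightarrow> (pm \<Rightarrow> int \<Rightarrow> complex) \<Rightarrow> 'v set"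
where
  "loop_weight_space scale \<Phi> \<psi> =
     {x. \<exists>p::nat. \<forall>\<epsilon> s. ((\<lambda>y. \<Phi> \<epsilon> s y - scale (\<psi> \<epsilon> s) y) ^^ p) x = 0}"

text \<open>Expansions in \<open>\<complex>[[u]]\<close> and \<open>\<complex>[[u^-1]]\<close> are compared in the field of formal Laurent series
  in \<open>z\<close>, with \<open>z = u\<close> for \<open>+\<close> and \<open>z = u^-1\<close> for \<open>-\<close>. Substituting for \<open>u\<close> the series
  \<open>z\<close>, respectively \<open>z^-1\<close>, in a rational function expands it at \<open>u = 0\<close>, respectively at
  \<open>u = \<infinity>\<close>.\<close>

fun loop_var :: "pm \<Rightarrow> complex fls" where
  "loop_var Plus = fls_X"
| "loop_var Minus = fls_X_inv"

definition poly_at_fls :: "complex poly \<Rightarrow> complex fls \<Rightarrow> complex fls" where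
  "poly_at_fls P U = poly (map_poly fls_const P) U"

definition loop_weight_fls :: "complex \<Rightarrow> complex poly \<Rightarrow> complex poly \<Rightarrow> complex fls \<Rightarrow> complex fls" where
  "loop_weight_fls q Q R U =
     fls_const (q powi (int (degree Q) - int (degree R)))
     * ((poly_at_fls Q (fls_const (q powi (- 2)) * U) * poly_at_fls R U)
        / (poly_at_fls Q U * poly_at_fls R (fls_const (q powi (- 2)) * U)))"

definition has_weight_series ::
  "complex \<Rightarrow> complex poly \<Rightarrow> complex poly \<Rightarrow> pm \<Rightarrow> (nat \<Rightarrow> complex) \<Rightarrow> bool" where
  "has_weight_series q Q R \<epsilon> c \<longleftrightarrow>
     fps_to_fls (Abs_fps c) = loop_weight_fls q Q R (loop_var \<epsilon>)"

text \<open>The family \<open>\<psi>\<close> has loop-weight \<open>QR\<^sup>-\<^sup>1\<close>.\<close>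

definition has_loop_weight ::
  "complex \<Rightarrow> (pm \<Rightarrow> int \<Rightarrow> complex) \<Rightarrow> complex poly \<Rightarrow> complex poly \<Rightarrow> bool" where
  "has_loop_weight q \<psi> Q R \<longleftrightarrow> coeff Q 0 = 1 \<and> coeff R 0 = 1 \<and>
     (\<forall>\<epsilon>. has_weight_series q Q R \<epsilon> (\<lambda>n. \<psi> \<epsilon> (sg \<epsilon> * int n)))"

definition Q_poly :: "complex \<Rightarrow> nat \<Rightarrow> complex \<Rightarrow> nat \<Rightarrow> complex poly" where
  "Q_poly q r a k = (\<Prod>m\<in>{k+1..r}. [:1, - (q powi (int r - 2 * int m + 1) * a):])"

definition R_poly :: "complex \<Rightarrow> nat \<Rightarrow> complex \<Rightarrow> nat \<Rightarrow> complex poly" where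
  "R_poly q r a k = (\<Prod>m\<in>{1..k}. [:1, - (q powi (int r - 2 * int m + 3) * a):])"

end

theory Submission
  imports Defs
begin

text \<open>
  The representation prescribes \<open>K\<close> and the \<open>X\<^sup>\<pm>\<close> but not the \<open>H s\<close>, out of which the \<open>\<Phi>\<^sup>\<pm>\<close> are
  built. The \<open>H s\<close> can nevertheless be bypassed: since \<open>\<Phi>\<^sup>+\<close> lives in non-negative and \<open>\<Phi>\<^sup>-\<close> in
  non-positive degrees, only one of the two terms on the right of
  \<open>[X\<^sup>+\<^sub>s, X\<^sup>-\<^sub>0] = (\<Phi>\<^sup>+\<^sub>s - \<Phi>\<^sup>-\<^sub>s) / (q - q^-1)\<close> survives when \<open>s \<noteq> 0\<close>. So \<open>\<Phi>\<^sup>\<pm>\<^sub>s\<close> is a multiple of a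
  commutator of known operators, and \<open>\<Phi>\<^sup>\<pm>\<^sub>0 = K^\<pm>1\<close>. As \<open>X\<^sup>+\<close> lowers and \<open>X\<^sup>-\<close> raises the index of a
  basis vector by one, every \<open>\<Phi>\<^sup>\<pm>\<^sub>s\<close> is diagonal in the basis \<open>v\<close> (\<open>Phi_basis\<close>), and its
  eigenvalue on \<open>v k\<close> is, for \<open>s \<noteq> 0\<close> in the allowed range, \<open>\<pm>(A \<alpha>^s - B \<beta>^s)\<close> with
  \<open>\<alpha> = q^(r-2k-1) a\<close>, \<open>\<beta> = q^(r-2k+1) a\<close>, \<open>A = (q - q^-1) [k+1] [r-k]\<close> and
  \<open>B = (q - q^-1) [r-k+1] [k]\<close>.

  On the other side, the roots of \<open>Q\<close> and of \<open>R\<close> form strings of ratio \<open>q^2\<close>, so the quotient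
  defining the loop-weight telescopes (\<open>loop_weight_telescoped\<close>) to
  \<open>c0 (1 - \<gamma> u) (1 - \<delta> u) / ((1 - \<alpha> u) (1 - \<beta> u))\<close> with \<open>c0 = q^(r-2k)\<close>, \<open>\<gamma> = q^(-r-1) a\<close> and
  \<open>\<delta> = q^(r+1) a\<close>. Its partial fraction decomposition is
  \<open>c0 + A \<alpha> u / (1 - \<alpha> u) - B \<beta> u / (1 - \<beta> u)\<close>, and expanding the two geometric series, in \<open>u\<close> or
  in \<open>u^-1\<close>, gives exactly the eigenvalues above (\<open>Phi_eigenvalue_has_loop_weight\<close>).

  Finally, \<open>q\<close> is not a root of unity, so already \<open>K = \<Phi>\<^sup>+\<^sub>0\<close> has pairwise distinct eigenvalues on
  the \<open>v k\<close>, which makes the loop-weight spaces lines (\<open>loop_weight_space_eq_line\<close>). A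
  common eigenvector has some non-zero coordinate, say at \<open>v k\<close>, and comparing that coordinate
  shows that its eigenvalues are those of \<open>v k\<close> (\<open>common_eigenvalue\<close>).
\<close>

section \<open>Evaluation of polynomials at a Laurent series\<close>

lemma poly_at_fls_0 [simp]: "poly_at_fls 0 U = 0"
  by (simp add: poly_at_fls_def)

lemma poly_at_fls_pCons [simp]:
  "poly_at_fls (pCons c P) U = fls_const c + U * poly_at_fls P U"
  by (simp add: poly_at_fls_def map_poly_pCons)

lemma poly_at_fls_1 [simp]: "poly_at_fls 1 U = 1"
  by (simp add: one_pCons)

lemma poly_at_fls_add: "poly_at_fls (P + Q) U = poly_at_fls P U + poly_at_fls Q U"
  by (induction P Q rule: poly_induct2) (auto simp: algebra_simps simp flip: fls_plus_const)

lemma poly_at_fls_smult: "poly_at_fls (smult c P) U = fls_const c * poly_at_fls P U"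
  by (induction P) (auto simp: algebra_simps)

lemma poly_at_fls_mult: "poly_at_fls (P * Q) U = poly_at_fls P U * poly_at_fls Q U"
  by (induction P) (simp_all add: algebra_simps poly_at_fls_add poly_at_fls_smult)

lemma poly_at_fls_prod: "poly_at_fls (prod P I) U = (\<Prod>i\<in>I. poly_at_fls (P i) U)"
  by (induction I rule: infinite_finite_induct) (auto simp: poly_at_fls_mult)

section \<open>Expansion at zero and at infinity\<close>

abbreviation lin :: "complex \<Rightarrow> complex fls \<Rightarrow> complex fls" where
  "lin c U \<equiv> 1 - fls_const c * U"

lemma lin_nonzero: "lin c (loop_var \<epsilon>) \<noteq> 0"
proof
  assume "lin c (loop_var \<epsilon>) = 0"
  then have "fls_nth (lin c (loop_var \<epsilon>)) 0 = 0" by simp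
  then show False by (cases \<epsilon>) auto
qed

text \<open>The two expansions of \<open>c u / (1 - c u)\<close>: it is \<open>\<Sum>n\<ge>1. c^n u^n\<close> at \<open>0\<close> but
  \<open>- (\<Sum>n\<ge>0. c^-n u^-n)\<close> at \<open>\<infinity>\<close>. Apart from the sign they differ in the constant term, which is
  why the latter is listed separately.\<close>

lemma geometric_expansion:
  assumes "c \<noteq> 0"
  shows "fps_to_fls (Abs_fps (\<lambda>n. if n = 0 then (if \<epsilon> = Plus then 0 else - 1)
           else of_int (sg \<epsilon>) * c powi (sg \<epsilon> * int n))) * lin c (loop_var \<epsilon>)
         = fls_const c * loop_var \<epsilon>"
proof (rule fls_eqI)
  fix n :: int
  let ?F = "fps_to_fls (Abs_fps (\<lambda>n. if n = 0 then (if \<epsilon> = Plus then 0 else - 1)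
           else of_int (sg \<epsilon>) * c powi (sg \<epsilon> * int n)))"
  have eq: "?F * lin c (loop_var \<epsilon>) = ?F - fls_const c * (?F * loop_var \<epsilon>)"
    by (simp add: algebra_simps)
  have pw: "c * c powi m = c powi (m + 1)" for m
    using assms by (simp add: power_int_add)
  show "fls_nth (?F * lin c (loop_var \<epsilon>)) n = fls_nth (fls_const c * loop_var \<epsilon>) n"
    unfolding eq
  proof (cases \<epsilon>)
    case Plus
    have "n < 0 \<or> n = 0 \<or> n = 1 \<or> n > 1" by linarith
    with Plus show "fls_nth (?F - fls_const c * (?F * loop_var \<epsilon>)) n = fls_nth (fls_const c * loop_var \<epsilon>) n"
      using assms by (auto simp: fls_X_times_conv_shift pw nat_diff_distrib)
  next
    case Minus
    have "n < -1 \<or> n = -1 \<or> n = 0 \<or> n \<ge> 1" by linarith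
    with Minus show "fls_nth (?F - fls_const c * (?F * loop_var \<epsilon>)) n = fls_nth (fls_const c * loop_var \<epsilon>) n"
      using assms by (auto simp: fls_X_inv_times_conv_shift pw power_int_minus)
  qed
qed

section \<open>The loop-weight as a rational function\<close>

lemma prod_shift_quotient:
  fixes f :: "nat \<Rightarrow> 'a::field"
  assumes "\<And>m. f m \<noteq> 0" "i \<le> j"
  shows "(\<Prod>m\<in>{i+1..j}. f (m + 1)) / (\<Prod>m\<in>{i+1..j}. f m) = f (j + 1) / f (i + 1)"
  using assms(2)
proof (induction j rule: dec_induct)
  case base
  then show ?case using assms by simp
next
  case (step j)
  then show ?case using assms(1) by (simp add: field_simps)
qed

lemma degree_Q_poly:
  assumes "q \<noteq> 0" "a \<noteq> 0" "k \<le> r"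
  shows "degree (Q_poly q r a k) = r - k"
  unfolding Q_poly_def using assms by (subst degree_prod_sum_eq) auto

lemma degree_R_poly:
  assumes "q \<noteq> 0" "a \<noteq> 0"
  shows "degree (R_poly q r a k) = k"
  unfolding R_poly_def using assms by (subst degree_prod_sum_eq) auto

lemma coeff_0_Q_poly: "coeff (Q_poly q r a k) 0 = 1"
  by (simp add: Q_poly_def poly_0_coeff_0[symmetric] poly_prod)

lemma coeff_0_R_poly: "coeff (R_poly q r a k) 0 = 1"
  by (simp add: R_poly_def poly_0_coeff_0[symmetric] poly_prod)

text \<open>Replacing \<open>u\<close> by \<open>q^-2 u\<close> moves the factor with index \<open>m\<close> of \<open>Q\<close> or \<open>R\<close> to the one with
  index \<open>m + 1\<close>, so in each of the two quotients only the factors at the ends survive.\<close>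

lemma loop_weight_telescoped:
  fixes q a :: complex and \<epsilon> :: pm
  assumes "q \<noteq> 0" "a \<noteq> 0" "k \<le> r"
  defines "U \<equiv> loop_var \<epsilon>"
  shows "loop_weight_fls q (Q_poly q r a k) (R_poly q r a k) U =
    fls_const (q powi (int r - 2 * int k))
    * (lin (q powi (- int r - 1) * a) U * lin (q powi (int r + 1) * a) U
       / (lin (q powi (int r - 2 * int k - 1) * a) U * lin (q powi (int r - 2 * int k + 1) * a) U))"
proof -
  have shift: "q powi i * q powi (- 2) = q powi (i - 2)" for i
    using assms(1) by (simp add: power_int_add[symmetric])
  define f where "f = (\<lambda>m. lin (q powi (int r - 2 * int m + 1) * a) U)"
  define g where "g = (\<lambda>m. lin (q powi (int r - 2 * int m + 3) * a) U)"
  have lin_scaled: "lin (q powi i * a) (fls_const (q powi (- 2)) * U) = lin (q powi (i - 2) * a) U" for i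
    by (simp only: shift[symmetric] fls_const_mult_const[symmetric] ac_simps)
  have at: "poly_at_fls [:1, - c:] W = lin c W" for c W
    by simp
  have Q: "poly_at_fls (Q_poly q r a k) U = (\<Prod>m\<in>{k+1..r}. f m)"
    "poly_at_fls (Q_poly q r a k) (fls_const (q powi (- 2)) * U) = (\<Prod>m\<in>{k+1..r}. f (m + 1))"
    unfolding Q_poly_def poly_at_fls_prod at lin_scaled f_def
    by (auto intro!: prod.cong simp: algebra_simps)
  \<comment> \<open>the range is written \<open>{0+1..k}\<close> so that \<open>prod_shift_quotient\<close> applies with \<open>i = 0\<close>\<close>
  have R: "poly_at_fls (R_poly q r a k) U = (\<Prod>m\<in>{0+1..k}. g m)"
    "poly_at_fls (R_poly q r a k) (fls_const (q powi (- 2)) * U) = (\<Prod>m\<in>{0+1..k}. g (m + 1))"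
    unfolding R_poly_def poly_at_fls_prod at lin_scaled g_def
    by (auto intro!: prod.cong simp: algebra_simps)
  have nz: "f m \<noteq> 0" "g m \<noteq> 0" for m
    unfolding f_def g_def U_def by (rule lin_nonzero)+
  have "loop_weight_fls q (Q_poly q r a k) (R_poly q r a k) U = fls_const (q powi (int r - 2 * int k))
     * (((\<Prod>m\<in>{k+1..r}. f (m + 1)) / (\<Prod>m\<in>{k+1..r}. f m))
        / ((\<Prod>m\<in>{0+1..k}. g (m + 1)) / (\<Prod>m\<in>{0+1..k}. g m)))"
    unfolding loop_weight_fls_def Q R using assms
    by (simp add: degree_Q_poly degree_R_poly of_nat_diff)
  also have "\<dots> = fls_const (q powi (int r - 2 * int k)) * ((f (r + 1) / f (k + 1)) / (g (k + 1) / g (0 + 1)))"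
    by (subst (1 2) prod_shift_quotient) (use nz assms in auto)
  also have "\<dots> = fls_const (q powi (int r - 2 * int k)) * (f (r + 1) * g 1 / (f (k + 1) * g (k + 1)))"
    by simp
  also have "f (r + 1) = lin (q powi (- int r - 1) * a) U"
    unfolding f_def by (rule arg_cong[of _ _ "\<lambda>i. lin (q powi i * a) U"]) simp
  also have "g 1 = lin (q powi (int r + 1) * a) U"
    by (simp add: g_def algebra_simps)
  also have "f (k + 1) = lin (q powi (int r - 2 * int k - 1) * a) U"
    by (simp add: f_def algebra_simps)
  also have "g (k + 1) = lin (q powi (int r - 2 * int k + 1) * a) U"
    by (simp add: g_def algebra_simps)
  finally show ?thesis .
qed

text \<open>The hypotheses \<open>sum\<close> and \<open>prod\<close> compare the coefficients of \<open>U\<close> and \<open>U^2\<close> in the numerators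
  over the common denominator. The fractions \<open>F\<close> and \<open>G\<close> are given by the equations that
  characterise them, in the form in which \<open>geometric_expansion\<close> provides them.\<close>

lemma partial_fractions:
  fixes F G U c0 A B :: "'a::field"
  assumes "1 - \<alpha> * U \<noteq> 0" "1 - \<beta> * U \<noteq> 0"
    and "F * (1 - \<alpha> * U) = \<alpha> * U" "G * (1 - \<beta> * U) = \<beta> * U"
    and sum: "c0 * (\<gamma> + \<delta>) = c0 * (\<alpha> + \<beta>) - A * \<alpha> + B * \<beta>"
    and prod: "c0 * (\<gamma> * \<delta>) = (c0 - A + B) * (\<alpha> * \<beta>)"
  shows "c0 + A * F - B * G
    = c0 * ((1 - \<gamma> * U) * (1 - \<delta> * U) / ((1 - \<alpha> * U) * (1 - \<beta> * U)))"
proof -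
  have F: "F = \<alpha> * U / (1 - \<alpha> * U)" and G: "G = \<beta> * U / (1 - \<beta> * U)"
    using assms by (simp_all add: eq_divide_eq)
  have "c0 * ((1 - \<gamma> * U) * (1 - \<delta> * U)) = c0 - (c0 * (\<gamma> + \<delta>)) * U + (c0 * (\<gamma> * \<delta>)) * U\<^sup>2"
    by (simp add: algebra_simps power2_eq_square)
  also have "\<dots> = c0 * ((1 - \<alpha> * U) * (1 - \<beta> * U)) + A * (\<alpha> * U) * (1 - \<beta> * U)
      - B * (\<beta> * U) * (1 - \<alpha> * U)"
    unfolding sum prod by (simp add: algebra_simps power2_eq_square)
  finally show ?thesis
    unfolding F G using assms(1,2) by (simp add: divide_simps) (simp add: algebra_simps)
qed

text \<open>The eigenvalue of \<open>\<Phi>\<^sup>\<epsilon>\<^sub>s\<close> on \<open>v k\<close>. The two products of \<open>q\<close>-integers come from the paths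
  \<open>v k \<rightarrow> v (k + 1) \<rightarrow> v k\<close> and \<open>v k \<rightarrow> v (k - 1) \<rightarrow> v k\<close> in the commutator \<open>[X\<^sup>+\<^sub>s, X\<^sup>-\<^sub>0]\<close>.\<close>

definition Phi_eigenvalue :: "complex \<Rightarrow> nat \<Rightarrow> complex \<Rightarrow> nat \<Rightarrow> pm \<Rightarrow> int \<Rightarrow> complex" where
  "Phi_eigenvalue q r a k \<epsilon> s =
     (if sg \<epsilon> * s < 0 then 0
      else if s = 0 then q powi (sg \<epsilon> * (int r - 2 * int k))
      else of_int (sg \<epsilon>) * (q - inverse q) *
        (qint q (int k + 1) * qint q (int r - int k) * (q powi (int r - 2 * int k - 1) * a) powi s
         - qint q (int r - int k + 1) * qint q (int k) * (q powi (int r - 2 * int k + 1) * a) powi s))"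

text \<open>The coefficient identities for the partial fraction decomposition. The first says that
  the decomposition has the value \<open>q^-(r-2k)\<close> at \<open>u = \<infinity>\<close>, which is the eigenvalue of \<open>K^-1\<close>. All
  three become identities of rational functions in \<open>q\<close>, \<open>x = q^r\<close> and \<open>y = q^k\<close>.\<close>

lemma
  fixes q a :: complex and r k :: nat
  assumes q: "q \<noteq> 0" "q\<^sup>2 \<noteq> 1"
  defines "A \<equiv> (q - inverse q) * (qint q (int k + 1) * qint q (int r - int k))"
    and "B \<equiv> (q - inverse q) * (qint q (int r - int k + 1) * qint q (int k))"
    and "c0 \<equiv> q powi (int r - 2 * int k)"
    and "\<alpha> \<equiv> q powi (int r - 2 * int k - 1) * a"
    and "\<beta> \<equiv> q powi (int r - 2 * int k + 1) * a"
    and "\<gamma> \<equiv> q powi (- int r - 1) * a"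
    and "\<delta> \<equiv> q powi (int r + 1) * a"
  shows residue_difference: "c0 - A + B = q powi (- (int r - 2 * int k))"
    and residue_sum: "c0 * (\<gamma> + \<delta>) = c0 * (\<alpha> + \<beta>) - A * \<alpha> + B * \<beta>"
    and residue_prod: "c0 * (\<gamma> * \<delta>) = (c0 - A + B) * (\<alpha> * \<beta>)"
proof -
  define x where "x = q ^ r"
  define y where "y = q ^ k"
  have xy: "x \<noteq> 0" "y \<noteq> 0" using q by (auto simp: x_def y_def)
  have q2: "q * q - 1 \<noteq> 0" using q by (simp add: power2_eq_square)
  have h: "q - inverse q = (q * q - 1) / q" using q by (simp add: field_simps)
  have pw: "q powi (2 * int k) = y\<^sup>2"
    by (simp add: y_def power_int_def nat_mult_distrib power_mult[symmetric] mult.commute)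
  have A: "A = (y\<^sup>2 * q\<^sup>2 - 1) * (x\<^sup>2 - y\<^sup>2) / (y\<^sup>2 * x * (q * q - 1))"
    unfolding A_def qint_def h using q xy q2
    by (simp add: power_int_add power_int_diff power_int_minus x_def[symmetric] y_def[symmetric])
      (simp add: divide_simps, simp add: algebra_simps power2_eq_square)
  have B: "B = (x\<^sup>2 * q\<^sup>2 - y\<^sup>2) * (y\<^sup>2 - 1) / (y\<^sup>2 * x * (q * q - 1))"
    unfolding B_def qint_def h using q xy q2
    by (simp add: power_int_add power_int_diff power_int_minus x_def[symmetric] y_def[symmetric])
      (simp add: divide_simps, simp add: algebra_simps power2_eq_square)
  have c0: "c0 = x / y\<^sup>2" and c0': "q powi (- (int r - 2 * int k)) = y\<^sup>2 / x"
    and al: "\<alpha> = x / y\<^sup>2 / q * a" and be: "\<beta> = x / y\<^sup>2 * q * a"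
    and ga: "\<gamma> = a / (x * q)" and de: "\<delta> = x * q * a"
    using q unfolding c0_def \<alpha>_def \<beta>_def \<gamma>_def \<delta>_def
    by (simp_all add: power_int_add power_int_diff power_int_minus pw x_def divide_simps)
  show 1: "c0 - A + B = q powi (- (int r - 2 * int k))"
    unfolding c0' c0 A B using q xy q2
    by (simp add: divide_simps) (simp add: algebra_simps power2_eq_square power4_eq_xxxx)
  show "c0 * (\<gamma> * \<delta>) = (c0 - A + B) * (\<alpha> * \<beta>)"
    unfolding 1 unfolding c0' c0 al be ga de using q xy
    by (simp add: divide_simps power2_eq_square power4_eq_xxxx)
  show "c0 * (\<gamma> + \<delta>) = c0 * (\<alpha> + \<beta>) - A * \<alpha> + B * \<beta>"
    unfolding c0 A B al be ga de using q xy q2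
    by (simp add: divide_simps) (simp add: algebra_simps power2_eq_square power4_eq_xxxx)
qed

lemma Phi_eigenvalue_has_loop_weight:
  fixes q a :: complex
  assumes q: "q \<noteq> 0" "q\<^sup>2 \<noteq> 1" and a: "a \<noteq> 0" and k: "k \<le> r"
  shows "has_loop_weight q (Phi_eigenvalue q r a k) (Q_poly q r a k) (R_poly q r a k)"
proof -
  define A where "A = (q - inverse q) * (qint q (int k + 1) * qint q (int r - int k))"
  define B where "B = (q - inverse q) * (qint q (int r - int k + 1) * qint q (int k))"
  define c0 where "c0 = q powi (int r - 2 * int k)"
  define \<alpha> where "\<alpha> = q powi (int r - 2 * int k - 1) * a"
  define \<beta> where "\<beta> = q powi (int r - 2 * int k + 1) * a"
  define \<gamma> where "\<gamma> = q powi (- int r - 1) * a"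
  define \<delta> where "\<delta> = q powi (int r + 1) * a"
  note defs = A_def B_def c0_def \<alpha>_def \<beta>_def \<gamma>_def \<delta>_def
  have \<alpha>\<beta>: "\<alpha> \<noteq> 0" "\<beta> \<noteq> 0" using q a by (auto simp: \<alpha>_def \<beta>_def)
  have diff: "c0 - A + B = q powi (- (int r - 2 * int k))"
    and sum: "c0 * (\<gamma> + \<delta>) = c0 * (\<alpha> + \<beta>) - A * \<alpha> + B * \<beta>"
    and prod: "c0 * (\<gamma> * \<delta>) = (c0 - A + B) * (\<alpha> * \<beta>)"
    unfolding defs by (rule residue_difference residue_sum residue_prod; fact q)+
  have "has_weight_series q (Q_poly q r a k) (R_poly q r a k) \<epsilon>
          (\<lambda>n. Phi_eigenvalue q r a k \<epsilon> (sg \<epsilon> * int n))" for \<epsilon>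
  proof -
    define U where "U = loop_var \<epsilon>"
    define G where "G = (\<lambda>c. Abs_fps (\<lambda>n. if n = 0 then (if \<epsilon> = Plus then 0 else - 1)
           else of_int (sg \<epsilon>) * c powi (sg \<epsilon> * int n)) :: complex fps)"
    have G: "fps_to_fls (G c) * lin c U = fls_const c * U" if "c \<noteq> 0" for c
      unfolding G_def U_def by (rule geometric_expansion[OF that])
    have "Abs_fps (\<lambda>n. Phi_eigenvalue q r a k \<epsilon> (sg \<epsilon> * int n))
        = fps_const c0 + fps_const A * G \<alpha> - fps_const B * G \<beta>"
    proof (rule fps_ext)
      fix n
      show "fps_nth (Abs_fps (\<lambda>n. Phi_eigenvalue q r a k \<epsilon> (sg \<epsilon> * int n))) n
        = fps_nth (fps_const c0 + fps_const A * G \<alpha> - fps_const B * G \<beta>) n"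
      proof (cases "n = 0")
        case True
        then show ?thesis using diff
          by (cases \<epsilon>) (auto simp: Phi_eigenvalue_def G_def c0_def)
      next
        case False
        then have "sg \<epsilon> * (sg \<epsilon> * int n) > 0" by (cases \<epsilon>) auto
        then have "Phi_eigenvalue q r a k \<epsilon> (sg \<epsilon> * int n)
            = of_int (sg \<epsilon>) * (A * \<alpha> powi (sg \<epsilon> * int n) - B * \<beta> powi (sg \<epsilon> * int n))"
          unfolding Phi_eigenvalue_def defs by (auto simp: algebra_simps)
        with False show ?thesis by (simp add: G_def algebra_simps)
      qed
    qed
    then have "fps_to_fls (Abs_fps (\<lambda>n. Phi_eigenvalue q r a k \<epsilon> (sg \<epsilon> * int n)))
        = fls_const c0 + fls_const A * fps_to_fls (G \<alpha>) - fls_const B * fps_to_fls (G \<beta>)"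
      by (simp add: fls_times_fps_to_fls fps_to_fls_plus)
    also have "\<dots> = fls_const c0 * (lin \<gamma> U * lin \<delta> U / (lin \<alpha> U * lin \<beta> U))"
    proof (rule partial_fractions)
      show "lin \<alpha> U \<noteq> 0" "lin \<beta> U \<noteq> 0" unfolding U_def by (rule lin_nonzero)+
      show "fps_to_fls (G \<alpha>) * lin \<alpha> U = fls_const \<alpha> * U" "fps_to_fls (G \<beta>) * lin \<beta> U = fls_const \<beta> * U"
        using G \<alpha>\<beta> by auto
    qed (use sum prod in \<open>simp_all add: fls_plus_const fls_minus_const fls_const_mult_const\<close>)
    also have "\<dots> = loop_weight_fls q (Q_poly q r a k) (R_poly q r a k) U"
      unfolding U_def by (subst loop_weight_telescoped) (use q a k in \<open>simp_all add: defs\<close>)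
    finally show ?thesis unfolding has_weight_series_def U_def .
  qed
  then show ?thesis
    unfolding has_loop_weight_def by (simp add: coeff_0_Q_poly coeff_0_R_poly)
qed

section \<open>The diagonal action on the evaluation representation\<close>

context evaluation_rep
begin

abbreviation "\<Phi> \<equiv> loop_Phi scale q K Kinv H"

abbreviation comb :: "(nat \<Rightarrow> complex) \<Rightarrow> 'v" where
  "comb c \<equiv> \<Sum>j\<le>r. scale (c j) (v j)"

lemma comb_exists: "\<exists>c. x = comb c"
proof -
  have "x \<in> span (v ` {..r})" using basis_span by simp
  then obtain u where "x = (\<Sum>w\<in>v ` {..r}. scale (u w) w)"
    by (auto simp: span_finite)
  also have "\<dots> = comb (u \<circ> v)" by (subst sum.reindex[OF basis_inj]) simp
  finally show ?thesis by blast
qed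

lemma comb_eq_0:
  assumes "comb c = 0" "j \<le> r"
  shows "c j = 0"
proof -
  define u where "u = c \<circ> the_inv_into {..r} v"
  have u: "u (v i) = c i" if "i \<le> r" for i
    using that basis_inj by (simp add: u_def the_inv_into_f_f)
  have "(\<Sum>w\<in>v ` {..r}. scale (u w) w) = 0"
    using assms(1) by (subst sum.reindex[OF basis_inj]) (simp add: u)
  then have "u (v j) = 0"
    using independentD[OF basis_independent _ subset_refl, of u "v j"] assms(2) by simp
  then show ?thesis using u assms(2) by simp
qed

lemma comb_eq_iff: "comb c = comb d \<longleftrightarrow> (\<forall>j\<le>r. c j = d j)"
proof
  assume "comb c = comb d"
  then have "comb (\<lambda>j. c j - d j) = 0"
    by (simp add: scale_left_diff_distrib sum_subtractf)
  then show "\<forall>j\<le>r. c j = d j" using comb_eq_0[of "\<lambda>j. c j - d j"] by auto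
qed (auto intro: sum.cong)

lemma scale_comb: "scale b (comb c) = comb (\<lambda>j. b * c j)"
  by (simp add: scale_sum_right)

lemma Phi_0: "\<Phi> \<epsilon> 0 x = (case \<epsilon> of Plus \<Rightarrow> K | Minus \<Rightarrow> Kinv) x"
  by (simp add: loop_Phi_def oser_exp_def)

lemma Phi_wrong_sign: "sg \<epsilon> * s < 0 \<Longrightarrow> \<Phi> \<epsilon> s x = 0"
  by (simp add: loop_Phi_def)

text \<open>Of \<open>\<Phi>\<^sup>+\<^sub>s\<close> and \<open>\<Phi>\<^sup>-\<^sub>s\<close> the one with the other sign vanishes, so the relation between \<open>X\<^sup>+\<close>
  and \<open>X\<^sup>-\<close> expresses \<open>\<Phi>\<^sup>\<epsilon>\<^sub>s\<close> without the operators \<open>H\<close>.\<close>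

lemma Phi_commutator:
  assumes "q - inverse q \<noteq> 0" "sg \<epsilon> * s > 0"
  shows "\<Phi> \<epsilon> s x = scale (of_int (sg \<epsilon>) * (q - inverse q))
           (X Plus s (X Minus 0 x) - X Minus 0 (X Plus s x))"
proof -
  have "X Plus s (X Minus 0 x) - X Minus 0 (X Plus s x)
     = scale (1 / (q - inverse q)) (\<Phi> Plus s x - \<Phi> Minus s x)"
    using Xp_Xm[of s 0 x] by simp
  moreover have "\<Phi> Plus s x - \<Phi> Minus s x = scale (of_int (sg \<epsilon>)) (\<Phi> \<epsilon> s x)"
    using assms(2) by (cases \<epsilon>) (simp_all add: Phi_wrong_sign)
  moreover have "of_int (sg \<epsilon>) * of_int (sg \<epsilon>) = (1 :: complex)" by (cases \<epsilon>) auto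
  ultimately show ?thesis using assms(1) by simp
qed

lemma linear_Phi:
  assumes "q - inverse q \<noteq> 0"
  shows "Vector_Spaces.linear scale scale (\<Phi> \<epsilon> s)"
proof -
  interpret vector_space_pair scale scale by unfold_locales
  have XX: "Vector_Spaces.linear scale scale (\<lambda>x. X \<epsilon>1 i (X \<epsilon>2 j x))" for \<epsilon>1 \<epsilon>2 i j
    using Vector_Spaces.linear_compose[OF linear_X linear_X] by (simp add: o_def)
  consider "sg \<epsilon> * s < 0" | "s = 0" | "sg \<epsilon> * s > 0"
    by (cases \<epsilon>) (auto, linarith+)
  then show ?thesis
  proof cases
    case 1
    then have "\<Phi> \<epsilon> s = (\<lambda>_. 0)" by (auto simp: Phi_wrong_sign)
    then show ?thesis by (simp add: linear_zero)
  next
    case 2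
    have "\<Phi> \<epsilon> 0 = (case \<epsilon> of Plus \<Rightarrow> K | Minus \<Rightarrow> Kinv)" by (rule ext) (rule Phi_0)
    then show ?thesis using 2 linear_K linear_Kinv by (cases \<epsilon>) auto
  next
    case 3
    have "\<Phi> \<epsilon> s = (\<lambda>x. scale (of_int (sg \<epsilon>) * (q - inverse q))
           (X Plus s (X Minus 0 x) - X Minus 0 (X Plus s x)))"
      by (rule ext) (rule Phi_commutator[OF assms 3])
    then show ?thesis by (simp only:) (intro linear_compose_scale_right linear_compose_sub XX)
  qed
qed

lemma Phi_basis:
  assumes q: "q \<noteq> 0" "q - inverse q \<noteq> 0" and k: "k \<le> r"
  shows "\<Phi> \<epsilon> s (v k) = scale (Phi_eigenvalue q r a k \<epsilon> s) (v k)"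
proof -
  interpret vector_space_pair scale scale by unfold_locales
  have lin: "f (scale b x) = scale b (f x)" if "Vector_Spaces.linear scale scale f" for f b x
    using that by (rule linear_scale)
  have lin0: "f 0 = 0" if "Vector_Spaces.linear scale scale f" for f
    using that by (rule linear_0)
  consider "sg \<epsilon> * s < 0" | "s = 0" | "sg \<epsilon> * s > 0"
    by (cases \<epsilon>) (auto, linarith+)
  then show ?thesis
  proof cases
    case 1
    then show ?thesis by (simp add: Phi_wrong_sign Phi_eigenvalue_def)
  next
    case 2
    have "Kinv (v k) = scale (q powi - (int r - 2 * int k)) (v k)"
    proof -
      have "v k = Kinv (K (v k))" by (simp add: Kinv_K)
      also have "\<dots> = scale (q powi (int r - 2 * int k)) (Kinv (v k))"
        by (simp add: K_basis[OF k] lin[OF linear_Kinv])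
      finally have "scale (q powi - (int r - 2 * int k)) (v k)
          = scale (q powi - (int r - 2 * int k)) (scale (q powi (int r - 2 * int k)) (Kinv (v k)))"
        by (rule arg_cong)
      then show ?thesis using q by (simp add: power_int_add[symmetric])
    qed
    then show ?thesis using 2 K_basis[OF k]
      by (cases \<epsilon>) (simp_all add: Phi_0 Phi_eigenvalue_def)
  next
    case 3
    have pw: "a powi s * q powi (s * i) = (q powi i * a) powi s" for i
      by (simp add: power_int_mult_distrib power_int_mult mult.commute[of s])
    note Xp = Xp_basis[of _ s, unfolded pw] and Xm = Xm_basis[of _ 0, simplified]
    have 1: "X Plus s (X Minus 0 (v k)) = scale (qint q (int k + 1) * qint q (int r - int k)
        * (q powi (int r - 2 * int k - 1) * a) powi s) (v k)"
    proof (cases "k = r")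
      case True
      then show ?thesis
        by (simp add: Xm lin0[OF linear_X] qint_def)
    next
      case False
      then have "k + 1 \<le> r" using k by simp
      moreover have "int r - 2 * int (k + 1) + 1 = int r - 2 * int k - 1"
        "int r - int (k + 1) + 1 = int r - int k" by auto
      ultimately have "X Plus s (v (k + 1)) = scale ((q powi (int r - 2 * int k - 1) * a) powi s
          * qint q (int r - int k)) (v k)"
        using Xp[of "k + 1"] by (simp only:) simp
      then show ?thesis using False k by (simp add: Xm lin[OF linear_X] mult_ac)
    qed
    have 2: "X Minus 0 (X Plus s (v k)) = scale (qint q (int r - int k + 1) * qint q (int k)
        * (q powi (int r - 2 * int k + 1) * a) powi s) (v k)"
    proof (cases "k = 0")
      case True
      then show ?thesis
        by (simp add: Xp lin0[OF linear_X] qint_def)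
    next
      case False
      then have "X Minus 0 (v (k - 1)) = scale (qint q (int k)) (v k)"
        using Xm[of "k - 1"] k by (auto simp: of_nat_diff)
      then show ?thesis using False k by (simp add: Xp lin[OF linear_X] mult_ac)
    qed
    show ?thesis
      unfolding Phi_commutator[OF q(2) 3] 1 2 scale_left_diff_distrib[symmetric] scale_scale using 3
      by (auto simp: Phi_eigenvalue_def)
  qed
qed

lemma Phi_comb:
  assumes "q \<noteq> 0" "q - inverse q \<noteq> 0"
  shows "\<Phi> \<epsilon> s (comb c) = comb (\<lambda>j. Phi_eigenvalue q r a j \<epsilon> s * c j)"
proof -
  interpret vector_space_pair scale scale by unfold_locales
  show ?thesis
    by (simp add: linear_sum[OF linear_Phi[OF assms(2)]] linear_scale[OF linear_Phi[OF assms(2)]]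
        Phi_basis[OF assms] mult.commute)
qed

lemma Phi_shift_funpow_comb:
  assumes "q \<noteq> 0" "q - inverse q \<noteq> 0"
  shows "((\<lambda>y. \<Phi> \<epsilon> s y - scale b y) ^^ p) (comb c)
    = comb (\<lambda>j. (Phi_eigenvalue q r a j \<epsilon> s - b) ^ p * c j)"
proof (induction p)
  case (Suc p)
  have "\<Phi> \<epsilon> s (comb d) - scale b (comb d) = comb (\<lambda>j. (Phi_eigenvalue q r a j \<epsilon> s - b) * d j)" for d
    unfolding Phi_comb[OF assms] scale_comb sum_subtractf[symmetric]
      scale_left_diff_distrib[symmetric] left_diff_distrib[symmetric] ..
  then show ?case by (simp add: Suc mult.assoc)
qed simp

text \<open>One operator suffices for the inclusion in the line: on the coordinate at \<open>v j\<close>, a power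
  of \<open>K\<close> minus its eigenvalue on \<open>v k\<close> acts as a non-zero scalar unless \<open>j = k\<close>.\<close>

lemma loop_weight_space_eq_line:
  assumes q: "q \<noteq> 0" "q - inverse q \<noteq> 0"
    and inj: "\<And>i j :: int. q powi i = q powi j \<Longrightarrow> i = j" and k: "k \<le> r"
  shows "loop_weight_space scale \<Phi> (Phi_eigenvalue q r a k) = span {v k}"
proof (intro equalityI subsetI)
  fix x assume "x \<in> loop_weight_space scale \<Phi> (Phi_eigenvalue q r a k)"
  then obtain p where
    p: "((\<lambda>y. \<Phi> Plus 0 y - scale (Phi_eigenvalue q r a k Plus 0) y) ^^ p) x = 0"
    unfolding loop_weight_space_def by blast
  obtain c where x: "x = comb c" using comb_exists by blast
  have "c j = 0" if "j \<le> r" "j \<noteq> k" for j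
  proof -
    have "(Phi_eigenvalue q r a j Plus 0 - Phi_eigenvalue q r a k Plus 0) ^ p * c j = 0"
      using comb_eq_0[OF p[unfolded x Phi_shift_funpow_comb[OF q]] that(1)] .
    moreover have "Phi_eigenvalue q r a j Plus 0 \<noteq> Phi_eigenvalue q r a k Plus 0"
      using inj[of "int r - 2 * int j" "int r - 2 * int k"] that by (auto simp: Phi_eigenvalue_def)
    ultimately show ?thesis by simp
  qed
  then have "x = (\<Sum>j\<in>{k}. scale (c j) (v j))"
    unfolding x using k by (intro sum.mono_neutral_right) auto
  then show "x \<in> span {v k}" by (auto intro: span_scale span_base)
next
  fix x assume "x \<in> span {v k}"
  then obtain b where x: "x = scale b (v k)" by (auto simp: span_singleton)
  interpret vector_space_pair scale scale by unfold_locales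
  have "\<Phi> \<epsilon> s x - scale (Phi_eigenvalue q r a k \<epsilon> s) x = 0" for \<epsilon> s
    by (simp add: x linear_scale[OF linear_Phi[OF q(2)]] Phi_basis[OF q k] mult.commute)
  then show "x \<in> loop_weight_space scale \<Phi> (Phi_eigenvalue q r a k)"
    unfolding loop_weight_space_def by (auto intro!: exI[of _ 1])
qed

text \<open>The set \<open>I\<close> of pairs selects the operators of which \<open>x\<close> is an eigenvector: all of them, or
  only those of one sign.\<close>

lemma common_eigenvalue:
  assumes q: "q \<noteq> 0" "q - inverse q \<noteq> 0" and "x \<noteq> 0"
    and eig: "\<And>\<epsilon> s. (\<epsilon>, s) \<in> I \<Longrightarrow> \<Phi> \<epsilon> s x = scale (\<psi> \<epsilon> s) x"
  shows "\<exists>k\<le>r. \<forall>(\<epsilon>, s)\<in>I. \<psi> \<epsilon> s = Phi_eigenvalue q r a k \<epsilon> s"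
proof -
  obtain c where x: "x = comb c" using comb_exists by blast
  obtain k where k: "k \<le> r" "c k \<noteq> 0"
    using \<open>x \<noteq> 0\<close> unfolding x by (metis (no_types, lifting) atMost_iff scale_zero_left sum.neutral)
  have "\<psi> \<epsilon> s = Phi_eigenvalue q r a k \<epsilon> s" if "(\<epsilon>, s) \<in> I" for \<epsilon> s
  proof -
    have "Phi_eigenvalue q r a k \<epsilon> s * c k = \<psi> \<epsilon> s * c k"
      using eig[OF that] k(1) unfolding x Phi_comb[OF q] scale_comb comb_eq_iff by blast
    then show ?thesis using k(2) by simp
  qed
  then show ?thesis using k(1) by blast
qed

end

section \<open>Loop-weights of the evaluation representation\<close>

lemma power_int_inj_if_not_algebraic:
  fixes q :: complex
  assumes "q \<noteq> 0" "\<not> algebraic q" "q powi i = q powi j"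
  shows "i = j"
proof (rule ccontr)
  assume "i \<noteq> j"
  define n where "n = nat \<bar>i - j\<bar>"
  have n: "n > 0" using \<open>i \<noteq> j\<close> by (simp add: n_def)
  have "q powi (i - j) = 1" "q powi (j - i) = 1"
    using assms by (simp_all add: power_int_diff)
  then have "q ^ n = 1"
    by (cases "i \<ge> j") (auto simp: n_def power_int_def split: if_splits)
  then have "algebraic q"
    using n by (intro algebraicI[of "monom 1 n - 1"])
      (auto simp: coeff_monom coeff_1 poly_monom poly_eq_iff intro!: exI[of _ n])
  with assms show False by simp
qed

theorem corollary2p3p2p6:
  fixes scale :: "complex \<Rightarrow> 'v \<Rightarrow> 'v::ab_group_add"
    and q a :: complex
    and r :: nat
    and K Kinv :: "'v \<Rightarrow> 'v"
    and H :: "int \<Rightarrow> 'v \<Rightarrow> 'v"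
    and X :: "pm \<Rightarrow> int \<Rightarrow> 'v \<Rightarrow> 'v"
    and v :: "nat \<Rightarrow> 'v"
  assumes "q \<noteq> 0" and "\<not> algebraic q" and "a \<noteq> 0"
    and "evaluation_rep scale q K Kinv H X r a v"
  shows "(\<forall>k\<le>r. \<exists>\<psi>. has_loop_weight q \<psi> (Q_poly q r a k) (R_poly q r a k)
            \<and> loop_weight_space scale (loop_Phi scale q K Kinv H) \<psi> = module.span scale {v k})
    \<and> (\<forall>\<epsilon> c. (\<exists>x. x \<noteq> 0 \<and> (\<forall>n. loop_Phi scale q K Kinv H \<epsilon> (sg \<epsilon> * int n) x = scale (c n) x))
            \<longrightarrow> (\<exists>Q R. coeff Q 0 = 1 \<and> coeff R 0 = 1 \<and> has_weight_series q Q R \<epsilon> c))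
    \<and> (\<forall>\<psi>. (\<exists>x. x \<noteq> 0 \<and> (\<forall>\<epsilon> s. loop_Phi scale q K Kinv H \<epsilon> s x = scale (\<psi> \<epsilon> s) x))
            \<longrightarrow> (\<exists>Q R. has_loop_weight q \<psi> Q R))"
proof -
  interpret evaluation_rep scale q K Kinv H X r a v by fact
  have inj: "i = j" if "q powi i = q powi j" for i j :: int
    using power_int_inj_if_not_algebraic assms(1,2) that by blast
  have q2: "q\<^sup>2 \<noteq> 1" using inj[of 2 0] by auto
  then have qq: "q - inverse q \<noteq> 0"
    using assms(1) by (simp add: field_simps power2_eq_square)
  note weight = Phi_eigenvalue_has_loop_weight[OF assms(1) q2 assms(3)]
  show ?thesis
  proof (intro conjI allI impI)
    fix k assume k: "k \<le> r"
    show "\<exists>\<psi>. has_loop_weight q \<psi> (Q_poly q r a k) (R_poly q r a k)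
            \<and> loop_weight_space scale \<Phi> \<psi> = span {v k}"
      using weight[OF k] loop_weight_space_eq_line[OF assms(1) qq inj k] by blast
  next
    fix \<epsilon> c
    assume "\<exists>x. x \<noteq> 0 \<and> (\<forall>n. \<Phi> \<epsilon> (sg \<epsilon> * int n) x = scale (c n) x)"
    then obtain x where x: "x \<noteq> 0" "\<And>n. \<Phi> \<epsilon> (sg \<epsilon> * int n) x = scale (c n) x" by blast
    \<comment> \<open>\<open>c\<close> is indexed by degrees in \<open>z\<close>; \<open>nat (sg \<epsilon> * s)\<close> recovers the degree from the index \<open>s\<close>\<close>
    have sg: "nat (sg \<epsilon> * (sg \<epsilon> * int n)) = n" for n by (cases \<epsilon>) auto
    have "\<exists>k\<le>r. \<forall>(\<epsilon>', s)\<in>range (\<lambda>n. (\<epsilon>, sg \<epsilon> * int n)).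
        c (nat (sg \<epsilon>' * s)) = Phi_eigenvalue q r a k \<epsilon>' s"
      by (rule common_eigenvalue[OF assms(1) qq x(1)]) (auto simp: sg x(2))
    then obtain k where k: "k \<le> r" "\<forall>n. c n = Phi_eigenvalue q r a k \<epsilon> (sg \<epsilon> * int n)"
      by (auto simp: sg)
    then have "c = (\<lambda>n. Phi_eigenvalue q r a k \<epsilon> (sg \<epsilon> * int n))" by blast
    then show "\<exists>Q R. coeff Q 0 = 1 \<and> coeff R 0 = 1 \<and> has_weight_series q Q R \<epsilon> c"
      using weight[OF k(1)] unfolding has_loop_weight_def by blast
  next
    fix \<psi>
    assume "\<exists>x. x \<noteq> 0 \<and> (\<forall>\<epsilon> s. \<Phi> \<epsilon> s x = scale (\<psi> \<epsilon> s) x)"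
    then obtain x where x: "x \<noteq> 0" "\<And>\<epsilon> s. \<Phi> \<epsilon> s x = scale (\<psi> \<epsilon> s) x" by blast
    obtain k where k: "k \<le> r" "\<forall>(\<epsilon>, s)\<in>UNIV. \<psi> \<epsilon> s = Phi_eigenvalue q r a k \<epsilon> s"
      using common_eigenvalue[OF assms(1) qq x(1), of UNIV \<psi>] x(2) by auto
    then have "\<psi> = Phi_eigenvalue q r a k" by (auto intro!: ext)
    then show "\<exists>Q R. has_loop_weight q \<psi> Q R" using weight[OF k(1)] by blast
  qed
qed

end
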